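(* Let $n\ge 1$ and $m\ge 1$ be integers and let $A_1,\dots,A_{m-1}$ be real $(n+1)\times(n+1)$ matrices with $A_p^{T}=-A_p$ and $A_pA_q+A_qA_p=-2\delta_{pq}I$ for all $1\le p,q\le m-1$ (no matrices if $m=1$). Define $F:\mathbb{R}^{n+1}\times\mathbb{R}^{n+1}\to\mathbb{R}$ by $$F(x,y)=\langle x,y\rangle^2+\sum_{q=1}^{m-1}\langle A_qx,y\rangle^2 ,$$ and suppose that $F$ is not constant on $\mathbb{S}^n(1)\times\mathbb{S}^n(1)$. Then the restriction of $F$ to $\mathbb{S}^n(1)\times\mathbb{S}^n(1)$ is an isoparametric function and, for every $t\in(0,1)$, the level set $$M_t=\{(x,y)\in\mathbb{S}^n(1)\times\mathbb{S}^n(1): F(x,y)=t\}$$ is an isoparametric hypersurface of $\mathbb{S}^n(1)\times\mathbb{S}^n(1)$ whose product angle function satisfies $C\equiv 0$.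
   Context: $\mathbb{S}^n(r)$ is the sphere of radius $r$ centred at the origin in $\mathbb{R}^{n+1}$, and $\mathbb{S}^n(1)\times\mathbb{S}^n(1)$ carries the product Riemannian metric. A non-constant smooth function $f$ on a Riemannian manifold $X$ is called isoparametric if there exist smooth functions $a,b$ of one real variable such that $|\nabla f|^2=b(f)$ and $\Delta f=a(f)$, where $\nabla$ and $\Delta$ are the gradient and Laplacian of $X$. A regular level set $f^{-1}(t)$ of an isoparametric function is called an isoparametric hypersurface of $X$. The product structure $P$ on $T(\mathbb{S}^n\times\mathbb{S}^n)\cong T\mathbb{S}^n\times T\mathbb{S}^n$ is $P(v_1,v_2)=(v_1,-v_2)$. For a hypersurface with local unit normal field $N$, the product angle function is $C=\langle PN,N\rangle$ (independent of the choice of sign of $N$). *)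

theory Defs
  imports "HOL-Analysis.Analysis"
begin

section \<open>Smooth maps\<close>

text \<open>Class $C^k$ on an open subset of a Euclidean space, by iterated directional derivatives.\<close>

primrec Ck_on :: "nat \<Rightarrow> ('a::euclidean_space \<Rightarrow> 'b::real_normed_vector) \<Rightarrow> 'a set \<Rightarrow> bool" where
  "Ck_on 0 f S \<longleftrightarrow> continuous_on S f"
| "Ck_on (Suc k) f S \<longleftrightarrow>
     f differentiable_on S \<and> (\<forall>v. Ck_on k (\<lambda>x. frechet_derivative f (at x) v) S)"

definition smooth_on :: "('a::euclidean_space \<Rightarrow> 'b::real_normed_vector) \<Rightarrow> 'a set \<Rightarrow> bool" where
  "smooth_on f S \<longleftrightarrow> open S \<and> (\<forall>k. Ck_on k f S)"

section \<open>Calculus on embedded submanifolds of Euclidean space\<close>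

text \<open>
  Throughout, \<open>X\<close> is meant to be an embedded submanifold of a Euclidean space, with the
  Riemannian metric induced by the ambient inner product. The product metric on a product of
  two spheres is of this form, since the inner product of \<open>'a \<times> 'a\<close> is the sum of the inner
  products of the components.

  Functions and vector fields on \<open>X\<close> are total functions on the ambient space of which only the
  values on \<open>X\<close> matter. This is why derivatives are taken \<open>at p within X\<close>: such a derivative is
  not unique as a linear map on the ambient space, but its restriction to the tangent space of
  \<open>X\<close> at \<open>p\<close> is.
\<close>

definition smooth_function_on :: "'a::euclidean_space set \<Rightarrow> ('a \<Rightarrow> real) \<Rightarrow> bool" where
  "smooth_function_on X f \<longleftrightarrow>
     (\<forall>p\<in>X. \<exists>U g. p \<in> U \<and> smooth_on g U \<and> (\<forall>q\<in>U \<inter> X. g q = f q))"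

definition tangent_space :: "'a::euclidean_space set \<Rightarrow> 'a \<Rightarrow> 'a set" where
  "tangent_space X p =
     {v. \<exists>\<gamma> \<epsilon>. 0 < \<epsilon> \<and> smooth_on \<gamma> {-\<epsilon><..<\<epsilon>} \<and> \<gamma> ` {-\<epsilon><..<\<epsilon>} \<subseteq> X \<and>
            \<gamma> 0 = p \<and> (\<gamma> has_vector_derivative v) (at (0::real))}"

definition gradient :: "'a::euclidean_space set \<Rightarrow> ('a \<Rightarrow> real) \<Rightarrow> 'a \<Rightarrow> 'a" where
  "gradient X f p =
     (THE g. g \<in> tangent_space X p \<and>
        (\<exists>D. (f has_derivative D) (at p within X) \<and> (\<forall>v\<in>tangent_space X p. D v = g \<bullet> v)))"

text \<open>
  The Levi-Civita connection of the induced metric is the tangential part of the ambient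
  derivative, so the divergence of a tangent vector field \<open>V\<close>, i.e. the trace of
  $v \mapsto \nabla_v V$ on the tangent space, is the sum of $\langle D_e V, e\rangle$ over an
  orthonormal basis of the tangent space.
\<close>

definition orthonormal_basis_of :: "'a::euclidean_space set \<Rightarrow> 'a set \<Rightarrow> bool" where
  "orthonormal_basis_of T B \<longleftrightarrow> B \<subseteq> T \<and> span B = T \<and> pairwise orthogonal B \<and> (\<forall>e\<in>B. norm e = 1)"

definition divergence :: "'a::euclidean_space set \<Rightarrow> ('a \<Rightarrow> 'a) \<Rightarrow> 'a \<Rightarrow> real" where
  "divergence X V p =
     (THE c. \<exists>B D. orthonormal_basis_of (tangent_space X p) B \<and>
        (V has_derivative D) (at p within X) \<and> c = (\<Sum>e\<in>B. D e \<bullet> e))"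

definition laplacian :: "'a::euclidean_space set \<Rightarrow> ('a \<Rightarrow> real) \<Rightarrow> 'a \<Rightarrow> real" where
  "laplacian X f = divergence X (gradient X f)"

section \<open>Isoparametric functions and hypersurfaces\<close>

definition isoparametric_function :: "'a::euclidean_space set \<Rightarrow> ('a \<Rightarrow> real) \<Rightarrow> bool" where
  "isoparametric_function X f \<longleftrightarrow>
     smooth_function_on X f \<and> \<not> f constant_on X \<and>
     (\<exists>a b :: real \<Rightarrow> real. smooth_on a UNIV \<and> smooth_on b UNIV \<and>
        (\<forall>p\<in>X. (norm (gradient X f p))\<^sup>2 = b (f p) \<and> laplacian X f p = a (f p)))"

definition regular_level_set :: "'a::euclidean_space set \<Rightarrow> ('a \<Rightarrow> real) \<Rightarrow> real \<Rightarrow> 'a set \<Rightarrow> bool" where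
  "regular_level_set X f t M \<longleftrightarrow>
     M = {p \<in> X. f p = t} \<and> M \<noteq> {} \<and> (\<forall>p\<in>M. gradient X f p \<noteq> 0)"

definition isoparametric_hypersurface :: "'a::euclidean_space set \<Rightarrow> 'a set \<Rightarrow> bool" where
  "isoparametric_hypersurface X M \<longleftrightarrow>
     (\<exists>f t. isoparametric_function X f \<and> regular_level_set X f t M)"

section \<open>The product angle function in a product of two unit spheres\<close>

abbreviation sphere_product :: "('a::euclidean_space \<times> 'a) set" where
  "sphere_product \<equiv> sphere 0 1 \<times> sphere 0 1"

definition unit_normal_at :: "'a::euclidean_space set \<Rightarrow> 'a set \<Rightarrow> 'a \<Rightarrow> 'a \<Rightarrow> bool" where
  "unit_normal_at X M p N \<longleftrightarrow>
     N \<in> tangent_space X p \<and> norm N = 1 \<and> (\<forall>v\<in>tangent_space M p. N \<bullet> v = 0)"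

definition product_structure :: "'a::euclidean_space \<times> 'a \<Rightarrow> 'a \<times> 'a" where
  "product_structure v = (fst v, - snd v)"

text \<open>
  A hypersurface has exactly two unit normals $\pm N$ at each point, and both give the same
  value of $\langle PN, N\rangle$.
\<close>

definition product_angle :: "('a::euclidean_space \<times> 'a) set \<Rightarrow> 'a \<times> 'a \<Rightarrow> real" where
  "product_angle M p =
     (THE c. \<exists>N. unit_normal_at sphere_product M p N \<and> c = product_structure N \<bullet> N)"

end

theory Submission
  imports Defs
begin

text \<open>
  Put \<open>J 0 = id\<close> and \<open>J q = A q\<close>. The Clifford relations say that the vectors \<open>J q x\<close> are
  orthogonal and have the length of \<open>x\<close>, and the same holds for the adjoints \<open>K q\<close>. So on the
  product of the unit spheres \<open>F (x, y)\<close> is the squared length of the projection \<open>wJ\<close> of \<open>y\<close> to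
  the span of the \<open>J q x\<close>, and also that of the projection \<open>wK\<close> of \<open>x\<close> to the span of the \<open>K q y\<close>. The
  gradient is \<open>2 (wK - F x, wJ - F y)\<close>; both its components have squared length \<open>4 F (1 - F)\<close>,
  which gives \<open>C = 0\<close>, and the trace of its derivative gives \<open>\<Delta> F = 4 m - 4 (n + 1) F\<close>.

  The normal line of a level set is only known once its tangent space is known to be all of
  the orthogonal complement of the gradient. The required curves in the level set are obtained
  without the implicit function theorem: a curve in the product of the spheres is pushed into
  the level set by rescaling the components of \<open>y\<close> along and orthogonal to the span of the
  \<open>J q x\<close>, and this retraction does not change velocities that are orthogonal to the gradient.
\<close>

section \<open>A class of smooth maps\<close>

text \<open>\<open>Ck_on\<close> uses unrestricted derivatives \<open>at x\<close>, so openness of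
  \<open>S\<close> is what carries them from \<open>f\<close> to \<open>g\<close>. Both functions
  are generalised because the induction passes to their derivatives.\<close>

lemma Ck_on_cong:
  assumes "open S" and "\<And>x. x \<in> S \<Longrightarrow> f x = g x" and "Ck_on k f S"
  shows "Ck_on k g S"
  using assms(2,3)
proof (induction k arbitrary: f g)
  case 0
  then show ?case using continuous_on_cong by force
next
  case (Suc k)
  have d: "(g has_derivative f') (at x)" if "(f has_derivative f') (at x)" "x \<in> S" for x f'
    using has_derivative_transform_within_open[OF that(1) assms(1) that(2)] Suc.prems(1) by auto
  have fd: "(f has_derivative frechet_derivative f (at x)) (at x)" if "x \<in> S" for x
    using Suc.prems(2) that assms(1)
    by (auto simp: differentiable_on_eq_differentiable_at frechet_derivative_works[symmetric])
  have eq: "frechet_derivative f (at x) = frechet_derivative g (at x)" if "x \<in> S" for x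
    using frechet_derivative_at d fd that by blast
  have "g differentiable_on S"
    unfolding differentiable_on_eq_differentiable_at[OF assms(1)]
    using d fd differentiable_def by blast
  moreover have "Ck_on k (\<lambda>x. frechet_derivative g (at x) v) S" for v
    using Suc.IH[of "\<lambda>x. frechet_derivative f (at x) v"] eq Suc.prems(2) by auto
  ultimately show ?case by simp
qed

text \<open>Smoothness is reduced to closure of a class of functions under directional derivatives,
  so no product or chain rule for \<open>Ck_on\<close> has to be established.\<close>

lemma smooth_on_coinduct:
  assumes "open S" and "P f"
    and step: "\<And>f. P f \<Longrightarrow> \<exists>f'. (\<forall>v. P (\<lambda>x. f' x v)) \<and> (\<forall>x\<in>S. (f has_derivative f' x) (at x))"
  shows "smooth_on f S"
proof -
  have "Ck_on k f S" if "P f" for k f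
    using that
  proof (induction k arbitrary: f)
    case 0
    then obtain f' where "\<forall>x\<in>S. (f has_derivative f' x) (at x)" using step by blast
    then show ?case
      by (auto intro!: continuous_at_imp_continuous_on has_derivative_continuous)
  next
    case (Suc k)
    then obtain f' where f': "\<And>v. P (\<lambda>x. f' x v)" "\<And>x. x \<in> S \<Longrightarrow> (f has_derivative f' x) (at x)"
      using step by blast
    have "Ck_on k (\<lambda>x. frechet_derivative f (at x) v) S" for v
      by (rule Ck_on_cong[OF assms(1) _ Suc.IH[OF f'(1)[of v]]])
        (use f'(2) frechet_derivative_at in metis)
    moreover have "f differentiable_on S"
      using f'(2) by (auto simp: differentiable_on_eq_differentiable_at[OF assms(1)] differentiable_def)
    ultimately show ?case by simp
  qed
  then show ?thesis using assms(1,2) by (simp add: smooth_on_def)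
qed

text \<open>The class is closed under directional derivatives and large enough for
  \<open>sqsum\<close> and the curves used below. Positivity of the base keeps \<open>powr\<close>
  differentiable, with derivative again in the class.\<close>

inductive elementary_on :: "'a::euclidean_space set \<Rightarrow> ('a \<Rightarrow> real) \<Rightarrow> bool" for S where
  const: "elementary_on S (\<lambda>x. c)"
| bounded_linear: "bounded_linear f \<Longrightarrow> elementary_on S f"
| add: "elementary_on S f \<Longrightarrow> elementary_on S g \<Longrightarrow> elementary_on S (\<lambda>x. f x + g x)"
| mult: "elementary_on S f \<Longrightarrow> elementary_on S g \<Longrightarrow> elementary_on S (\<lambda>x. f x * g x)"
| powr: "elementary_on S f \<Longrightarrow> (\<And>x. x \<in> S \<Longrightarrow> 0 < f x) \<Longrightarrow> elementary_on S (\<lambda>x. f x powr c)"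

lemma elementary_on_has_derivative:
  assumes "elementary_on S f"
  shows "\<exists>f'. (\<forall>v. elementary_on S (\<lambda>x. f' x v)) \<and> (\<forall>x\<in>S. (f has_derivative f' x) (at x))"
  using assms
proof induction
  case (const c)
  show ?case
    by (rule exI[of _ "\<lambda>x v. 0"]) (auto intro: elementary_on.const)
next
  case (bounded_linear f)
  then show ?case
    by (intro exI[of _ "\<lambda>x. f"])
      (auto intro: elementary_on.const bounded_linear_imp_has_derivative)
next
  case (add f g)
  then obtain f' g' where "\<forall>v. elementary_on S (\<lambda>x. f' x v)" "\<forall>x\<in>S. (f has_derivative f' x) (at x)"
      "\<forall>v. elementary_on S (\<lambda>x. g' x v)" "\<forall>x\<in>S. (g has_derivative g' x) (at x)" by blast
  then show ?case
    by (intro exI[of _ "\<lambda>x v. f' x v + g' x v"])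
      (auto intro!: elementary_on.add has_derivative_add)
next
  case (mult f g)
  then obtain f' g' where "\<forall>v. elementary_on S (\<lambda>x. f' x v)" "\<forall>x\<in>S. (f has_derivative f' x) (at x)"
      "\<forall>v. elementary_on S (\<lambda>x. g' x v)" "\<forall>x\<in>S. (g has_derivative g' x) (at x)" by blast
  with mult.hyps show ?case
    by (intro exI[of _ "\<lambda>x v. f x * g' x v + f' x v * g x"])
      (auto intro!: elementary_on.add elementary_on.mult has_derivative_mult)
next
  case (powr f c)
  then obtain f' where f': "\<forall>v. elementary_on S (\<lambda>x. f' x v)" "\<forall>x\<in>S. (f has_derivative f' x) (at x)"
    by blast
  have "((\<lambda>x. f x powr c) has_derivative (\<lambda>v. f' x v * (c * f x powr (c - 1)))) (at x)" if "x \<in> S" for x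
    using DERIV_compose_FDERIV[OF has_real_derivative_powr] f'(2) powr.hyps that by blast
  with powr.hyps f'(1) show ?case
    by (intro exI[of _ "\<lambda>x v. f' x v * (c * f x powr (c - 1))"])
      (auto intro!: elementary_on.mult elementary_on.const elementary_on.powr)
qed

lemma elementary_on_sum:
  assumes "\<And>i. i \<in> I \<Longrightarrow> elementary_on S (f i)"
  shows "elementary_on S (\<lambda>x. \<Sum>i\<in>I. f i x)"
  using assms
  by (induction I rule: infinite_finite_induct)
    (auto intro: elementary_on.const elementary_on.add)

definition elementary_map_on ::
  "'a::euclidean_space set \<Rightarrow> ('a \<Rightarrow> 'b::euclidean_space) \<Rightarrow> bool" where
  "elementary_map_on S f \<longleftrightarrow> (\<forall>b\<in>Basis. elementary_on S (\<lambda>x. f x \<bullet> b))"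

lemma elementary_map_on_real [simp]: "elementary_map_on S f \<longleftrightarrow> elementary_on S f"
  by (simp add: elementary_map_on_def)

lemma elementary_map_on_smooth:
  fixes f :: "'a::euclidean_space \<Rightarrow> 'b::euclidean_space"
  assumes "open S" and "elementary_map_on S f"
  shows "smooth_on f S"
proof (rule smooth_on_coinduct[where P = "elementary_map_on S"])
  fix f :: "'a \<Rightarrow> 'b"
  assume "elementary_map_on S f"
  then have "\<forall>b\<in>Basis. \<exists>f'. (\<forall>v. elementary_on S (\<lambda>x. f' x v)) \<and>
      (\<forall>x\<in>S. ((\<lambda>x. f x \<bullet> b) has_derivative f' x) (at x))"
    unfolding elementary_map_on_def using elementary_on_has_derivative by blast
  then obtain f' where f': "\<And>b v. b \<in> Basis \<Longrightarrow> elementary_on S (\<lambda>x. f' b x v)"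
      "\<And>b x. b \<in> Basis \<Longrightarrow> x \<in> S \<Longrightarrow> ((\<lambda>x. f x \<bullet> b) has_derivative f' b x) (at x)"
    by metis
  have comp: "(\<Sum>b\<in>Basis. f' b x v *\<^sub>R b) \<bullet> c = f' c x v" if "c \<in> Basis" for x v c
    using that by (simp add: inner_sum_left inner_Basis if_distrib sum.delta cong: if_cong)
  show "\<exists>f'. (\<forall>v. elementary_map_on S (\<lambda>x. f' x v)) \<and> (\<forall>x\<in>S. (f has_derivative f' x) (at x))"
    using f' comp
    by (intro exI[of _ "\<lambda>x v. \<Sum>b\<in>Basis. f' b x v *\<^sub>R b"])
      (auto simp: elementary_map_on_def has_derivative_componentwise_within[of f])
qed (use assms in auto)

lemma elementary_map_on_const: "elementary_map_on S (\<lambda>x. c)"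
  by (simp add: elementary_map_on_def elementary_on.const)

lemma elementary_map_on_add:
  "elementary_map_on S f \<Longrightarrow> elementary_map_on S g \<Longrightarrow> elementary_map_on S (\<lambda>x. f x + g x)"
  by (simp add: elementary_map_on_def inner_add_left elementary_on.add)

lemma elementary_map_on_scaleR:
  "elementary_on S f \<Longrightarrow> elementary_map_on S g \<Longrightarrow> elementary_map_on S (\<lambda>x. f x *\<^sub>R g x)"
  by (simp add: elementary_map_on_def elementary_on.mult)

lemma elementary_map_on_diff:
  assumes "elementary_map_on S f" and "elementary_map_on S g"
  shows "elementary_map_on S (\<lambda>x. f x - g x)"
  using elementary_map_on_add[OF assms(1) elementary_map_on_scaleR[OF elementary_on.const[of S "-1"] assms(2)]]
  by simp

lemma elementary_map_on_sum:
  "(\<And>i. i \<in> I \<Longrightarrow> elementary_map_on S (f i)) \<Longrightarrow> elementary_map_on S (\<lambda>x. \<Sum>i\<in>I. f i x)"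
  by (simp add: elementary_map_on_def inner_sum_left elementary_on_sum)

lemma elementary_on_inner:
  assumes "elementary_map_on S f" and "elementary_map_on S g"
  shows "elementary_on S (\<lambda>x. f x \<bullet> g x)"
  unfolding euclidean_inner[of "f _" "g _"]
  using assms by (auto simp: elementary_map_on_def intro!: elementary_on_sum elementary_on.mult)

text \<open>By the adjoint, each coordinate of \<open>g (f x)\<close> is the inner product of
  \<open>f x\<close> with a fixed vector.\<close>

lemma elementary_map_on_linear:
  fixes f :: "'a::euclidean_space \<Rightarrow> 'b::euclidean_space" and g :: "'b \<Rightarrow> 'c::euclidean_space"
  assumes "linear g" and "elementary_map_on S f"
  shows "elementary_map_on S (\<lambda>x. g (f x))"
  unfolding elementary_map_on_def
proof
  fix b :: 'c
  show "elementary_on S (\<lambda>x. g (f x) \<bullet> b)"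
    using elementary_on_inner[OF assms(2) elementary_map_on_const[of S "adjoint g b"]]
    by (simp add: adjoint_works[OF assms(1)] inner_commute)
qed

lemma elementary_map_on_Pair:
  "elementary_map_on S f \<Longrightarrow> elementary_map_on S g \<Longrightarrow> elementary_map_on S (\<lambda>x. (f x, g x))"
  by (auto simp: elementary_map_on_def Basis_prod_def)

lemma elementary_map_on_id: "elementary_map_on S (\<lambda>x. x)"
  by (auto simp: elementary_map_on_def intro!: elementary_on.bounded_linear bounded_linear_inner_left)

lemmas elementary_intros = elementary_on.const elementary_on.add elementary_on.mult elementary_on.powr
  elementary_on_sum elementary_on_inner elementary_map_on_const elementary_map_on_add
  elementary_map_on_scaleR elementary_map_on_diff elementary_map_on_sum elementary_map_on_Pair

lemma elementary_on_linear_real: "elementary_on S (\<lambda>s::real. s)"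
  by (rule elementary_on.bounded_linear) (rule bounded_linear_ident)

section \<open>Calculus on submanifolds\<close>

text \<open>A derivative within \<open>X\<close> suffices for the chain rule because the curve stays
  in \<open>X\<close>; the parameter interval is a neighbourhood of 0, so the result is a full
  derivative at 0.\<close>

lemma has_vector_derivative_along_curve:
  assumes "(f has_derivative D) (at p within X)"
    and "0 < \<epsilon>" and "\<gamma> ` {-\<epsilon><..<\<epsilon>} \<subseteq> X" and "\<gamma> 0 = p"
    and "(\<gamma> has_vector_derivative v) (at (0::real))"
  shows "((\<lambda>s. f (\<gamma> s)) has_vector_derivative D v) (at 0)"
proof -
  have g: "(\<gamma> has_derivative (\<lambda>s. s *\<^sub>R v)) (at 0 within {-\<epsilon><..<\<epsilon>})"
    using assms(5) has_derivative_at_withinI by (auto simp: has_vector_derivative_def)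
  have "((\<lambda>s. f (\<gamma> s)) has_derivative (\<lambda>s. D (s *\<^sub>R v))) (at 0 within {-\<epsilon><..<\<epsilon>})"
    by (rule has_derivative_in_compose[OF g])
      (use has_derivative_subset[OF assms(1,3)] assms(4) in simp)
  then show ?thesis
    using assms(2) linear_cmul[OF has_derivative_linear[OF assms(1)]]
    by (simp add: has_vector_derivative_def at_within_open[of 0 "{-\<epsilon><..<\<epsilon>}"])
qed

text \<open>Both values are the velocity of \<open>f\<close> along the same curve. This makes the
  descriptions in \<open>gradient\<close> and \<open>divergence\<close> unique.\<close>

lemma derivative_unique_on_tangent_space:
  assumes "(f has_derivative D) (at p within X)" and "(f has_derivative D') (at p within X)"
    and "v \<in> tangent_space X p"
  shows "D v = D' v"
  using assms(3) has_vector_derivative_along_curve[OF assms(1)] has_vector_derivative_along_curve[OF assms(2)]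
  unfolding tangent_space_def by (blast intro: vector_derivative_unique_at)

text \<open>Two candidates have equal inner products with all tangent vectors; their difference is
  itself tangent, hence orthogonal to itself.\<close>

lemma gradient_eqI:
  assumes "subspace (tangent_space X p)" and "g \<in> tangent_space X p"
    and "(f has_derivative D) (at p within X)" and "\<And>v. v \<in> tangent_space X p \<Longrightarrow> D v = g \<bullet> v"
  shows "gradient X f p = g"
  unfolding gradient_def
proof (rule the_equality)
  fix h
  assume h: "h \<in> tangent_space X p \<and> (\<exists>D. (f has_derivative D) (at p within X) \<and>
    (\<forall>v\<in>tangent_space X p. D v = h \<bullet> v))"
  then have "h \<bullet> v = g \<bullet> v" if "v \<in> tangent_space X p" for v
    using derivative_unique_on_tangent_space[OF assms(3)] assms(4) that by metis
  then have "(h - g) \<bullet> (h - g) = 0"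
    using subspace_diff[OF assms(1)] h assms(2) by (simp add: inner_diff_left)
  then show "h = g" by simp
qed (use assms in blast)

text \<open>Expanding in \<open>Basis\<close> and moving \<open>L\<close> to its adjoint leaves the
  expansion of each \<open>b\<close> in \<open>B\<close>, which returns \<open>b\<close>.\<close>

lemma trace_orthonormal_basis:
  fixes L :: "'a::euclidean_space \<Rightarrow> 'a"
  assumes "linear L" and "finite B" and "pairwise orthogonal B" and "\<And>e. e \<in> B \<Longrightarrow> norm e = 1"
    and "span B = UNIV"
  shows "(\<Sum>e\<in>B. L e \<bullet> e) = (\<Sum>b\<in>Basis. L b \<bullet> b)"
proof -
  have exp: "(\<Sum>e\<in>B. (v \<bullet> e) *\<^sub>R e) = v" for v
    using orthonormal_basis_expand[of B v] assms by (simp add: pairwise_def)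
  have "(\<Sum>e\<in>B. L e \<bullet> e) = (\<Sum>e\<in>B. \<Sum>b\<in>Basis. (L e \<bullet> b) * (e \<bullet> b))"
    by (simp add: euclidean_inner[of "L e" e for e])
  also have "\<dots> = (\<Sum>b\<in>Basis. \<Sum>e\<in>B. (e \<bullet> adjoint L b) * (e \<bullet> b))"
    by (subst sum.swap) (simp add: adjoint_works[OF assms(1)])
  also have "\<dots> = (\<Sum>b\<in>Basis. (\<Sum>e\<in>B. (b \<bullet> e) *\<^sub>R e) \<bullet> adjoint L b)"
    unfolding inner_sum_left inner_scaleR_left by (simp add: inner_commute mult.commute)
  also have "\<dots> = (\<Sum>b\<in>Basis. L b \<bullet> b)"
    by (simp add: exp adjoint_works[OF assms(1)])
  finally show ?thesis .
qed

section \<open>The product of two unit spheres\<close>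

text \<open>For a unit vector \<open>x\<close> orthogonal to \<open>u\<close> this is
  \<open>x + s *\<^sub>R u\<close> divided by its norm. The explicit radicand is positive for every
  \<open>s\<close>, which keeps the curve in the elementary class.\<close>

definition normalized_line :: "'a::euclidean_space \<Rightarrow> 'a \<Rightarrow> real \<Rightarrow> 'a" where
  "normalized_line x u s = (1 + s * s * (u \<bullet> u)) powr (-1/2) *\<^sub>R (x + s *\<^sub>R u)"

lemma normalized_line_radicand_pos: "0 < 1 + s * s * (u \<bullet> u)" for s :: real
  by (simp add: add_pos_nonneg)

lemma normalized_line_0 [simp]: "normalized_line x u 0 = x"
  by (simp add: normalized_line_def)

lemma elementary_normalized_line: "elementary_map_on S (normalized_line x u)"
  unfolding normalized_line_def
  by (intro elementary_intros elementary_on_linear_real normalized_line_radicand_pos)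

lemma powr_minus_half_square: "0 < a \<Longrightarrow> a powr (-1/2) * a powr (-1/2) = 1 / (a::real)"
  by (simp add: powr_add[symmetric] powr_minus_divide)

lemma normalized_line_in_sphere:
  assumes "x \<bullet> x = 1" and "x \<bullet> u = 0"
  shows "normalized_line x u s \<bullet> normalized_line x u s = 1"
proof -
  let ?r = "1 + s * s * (u \<bullet> u)"
  have "(x + s *\<^sub>R u) \<bullet> (x + s *\<^sub>R u) = ?r"
    using assms by (simp add: inner_add_left inner_add_right inner_commute)
  then have "normalized_line x u s \<bullet> normalized_line x u s = (?r powr (-1/2) * ?r powr (-1/2)) * ?r"
    by (simp add: normalized_line_def)
  also have "\<dots> = 1"
    using normalized_line_radicand_pos[of s u] by (subst powr_minus_half_square) auto
  finally show ?thesis .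
qed

text \<open>The scalar factor is even in \<open>s\<close>, so it is stationary at 0, where it equals
  1.\<close>

lemma normalized_line_has_vector_derivative:
  "(normalized_line x u has_vector_derivative u) (at 0)"
  unfolding normalized_line_def
  by (auto intro!: derivative_eq_intros simp: has_vector_derivative_def)

lemma normalized_lines_in_sphere_product:
  assumes "(x, y) \<in> sphere_product" and "x \<bullet> u = 0" and "y \<bullet> v = 0"
  shows "(normalized_line x u s, normalized_line y v s) \<in> sphere_product"
  using assms normalized_line_in_sphere[of x u s] normalized_line_in_sphere[of y v s]
  by (simp add: norm_eq_1)

text \<open>Both components of a curve in the product have constant length, which forces the two
  equations; conversely a pair of normalized lines realises every such velocity.\<close>

lemma tangent_space_sphere_product:
  fixes x y :: "'a::euclidean_space"
  assumes p: "(x, y) \<in> sphere_product"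
  shows "tangent_space sphere_product (x, y) = {(u, v). x \<bullet> u = 0 \<and> y \<bullet> v = 0}"
proof (intro set_eqI iffI; clarify)
  fix u v
  assume "(u, v) \<in> tangent_space sphere_product (x, y)"
  then obtain \<gamma> \<epsilon> where e: "0 < \<epsilon>" and im: "\<gamma> ` {-\<epsilon><..<\<epsilon>} \<subseteq> (sphere_product :: ('a \<times> 'a) set)"
    and g: "\<gamma> 0 = (x, y)" "(\<gamma> has_vector_derivative (u, v)) (at 0)"
    unfolding tangent_space_def by blast
  \<comment> \<open>Taking \<open>l\<close> to be \<open>fst\<close> or \<open>snd\<close> treats
    both factors at once.\<close>
  have orth: "l (x, y) \<bullet> l (u, v) = 0"
    if "bounded_linear l" "\<And>q. q \<in> sphere_product \<Longrightarrow> l q \<bullet> l q = 1"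
    for l :: "'a \<times> 'a \<Rightarrow> 'a"
  proof -
    have "((\<lambda>q. l q \<bullet> l q) has_derivative (\<lambda>h. l (x, y) \<bullet> l h + l h \<bullet> l (x, y)))
        (at (x, y) within sphere_product)"
      by (intro has_derivative_inner bounded_linear_imp_has_derivative that)
    from has_vector_derivative_along_curve[OF this e im g]
    have 1: "((\<lambda>s. l (\<gamma> s) \<bullet> l (\<gamma> s)) has_vector_derivative
        (l (x, y) \<bullet> l (u, v) + l (u, v) \<bullet> l (x, y))) (at 0)" .
    have 2: "((\<lambda>s. l (\<gamma> s) \<bullet> l (\<gamma> s)) has_vector_derivative 0) (at 0)"
      by (rule has_vector_derivative_transform_within_open[of "\<lambda>s. 1" _ _ "{-\<epsilon><..<\<epsilon>}"])
        (use e im that(2) in \<open>auto simp: image_subset_iff\<close>)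
    from vector_derivative_unique_at[OF 1 2] show ?thesis by (simp add: inner_commute)
  qed
  show "x \<bullet> u = 0 \<and> y \<bullet> v = 0"
    using orth[OF bounded_linear_fst] orth[OF bounded_linear_snd] by (auto simp: norm_eq_1)
next
  fix u v
  assume uv: "x \<bullet> u = 0" "y \<bullet> v = 0"
  show "(u, v) \<in> tangent_space sphere_product (x, y)"
    unfolding tangent_space_def
    using normalized_lines_in_sphere_product[OF p uv]
    by (auto intro!: exI[of _ "\<lambda>s. (normalized_line x u s, normalized_line y v s)"] exI[of _ 1]
        elementary_map_on_smooth elementary_map_on_Pair elementary_normalized_line
        has_vector_derivative_Pair normalized_line_has_vector_derivative)
qed

lemma subspace_tangent_space_sphere_product:
  assumes "p \<in> sphere_product"
  shows "subspace (tangent_space sphere_product p)"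
  using assms
  by (cases p) (auto simp: tangent_space_sphere_product subspace_def inner_add_right zero_prod_def)

text \<open>The unit vectors \<open>(x, 0)\<close> and \<open>(0, y)\<close> span the normal space,
  so their two terms are removed from the ambient trace. The extension \<open>W\<close> provides a
  derivative on the whole space.\<close>

lemma divergence_sphere_product:
  fixes V W :: "'a::euclidean_space \<times> 'a \<Rightarrow> 'a \<times> 'a"
  assumes p: "(x, y) \<in> sphere_product"
    and VW: "\<And>q. q \<in> sphere_product \<Longrightarrow> V q = W q"
    and L: "(W has_derivative L) (at (x, y))"
  shows "divergence sphere_product V (x, y) =
    (\<Sum>b\<in>Basis. L b \<bullet> b) - L (x, 0) \<bullet> (x, 0) - L (0, y) \<bullet> (0, y)"
proof -
  let ?T = "tangent_space sphere_product (x, y)"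
  have T: "?T = {(u, v). x \<bullet> u = 0 \<and> y \<bullet> v = 0}"
    by (rule tangent_space_sphere_product[OF p])
  have xy: "x \<bullet> x = 1" "y \<bullet> y = 1" "norm x = 1" "norm y = 1" using p by (auto simp: norm_eq_1)
  have VL: "(V has_derivative L) (at (x, y) within sphere_product)"
    by (rule has_derivative_transform[OF p VW has_derivative_at_withinI[OF L]])
  have tr: "(\<Sum>e\<in>B. L e \<bullet> e) =
      (\<Sum>b\<in>Basis. L b \<bullet> b) - L (x, 0) \<bullet> (x, 0) - L (0, y) \<bullet> (0, y)"
    if B: "orthonormal_basis_of ?T B" for B
  proof -
    have B': "B \<subseteq> ?T" "span B = ?T" "pairwise orthogonal B" "\<And>e. e \<in> B \<Longrightarrow> norm e = 1"
      using B by (auto simp: orthonormal_basis_of_def)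
    \<comment> \<open>Without the zero vector, orthogonality gives independence and hence finiteness
      of \<open>B\<close>.\<close>
    have "0 \<notin> B"
      using B'(4) norm_zero zero_neq_one by metis
    then have "independent B"
      by (rule pairwise_orthogonal_independent[OF B'(3)])
    then have fin: "finite B" using independent_imp_finite by blast
    have nin: "(x, 0) \<notin> B" "(0, y) \<notin> B" "(x, 0) \<noteq> (0, y)"
      using B'(1) T xy by auto
    \<comment> \<open>The two normals complete \<open>B\<close> to an orthonormal basis of the
      ambient space.\<close>
    let ?C = "insert (x, 0) (insert (0, y) B)"
    have "(u, v) \<in> span ?C" for u v
    proof -
      have "(u - (u \<bullet> x) *\<^sub>R x, v - (v \<bullet> y) *\<^sub>R y) \<in> span B"
        unfolding B'(2) T using xy by (simp add: inner_diff_right inner_commute)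
      then have 1: "(u - (u \<bullet> x) *\<^sub>R x, v - (v \<bullet> y) *\<^sub>R y) \<in> span ?C"
        using span_mono[of B ?C] by blast
      have "(u - (u \<bullet> x) *\<^sub>R x, v - (v \<bullet> y) *\<^sub>R y) + (u \<bullet> x) *\<^sub>R (x, 0) + (v \<bullet> y) *\<^sub>R (0, y) \<in> span ?C"
        by (intro span_add span_scale 1 span_base) auto
      then show ?thesis by simp
    qed
    then have "span ?C = UNIV" by auto
    moreover have "pairwise orthogonal ?C"
      using B'(1,3) T by (auto simp: pairwise_insert orthogonal_def inner_commute)
    moreover have "\<And>e. e \<in> ?C \<Longrightarrow> norm e = 1" using B'(4) xy by (auto simp: norm_Pair)
    ultimately have "(\<Sum>e\<in>?C. L e \<bullet> e) = (\<Sum>b\<in>Basis. L b \<bullet> b)"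
      using trace_orthonormal_basis[OF has_derivative_linear[OF L], of ?C] fin by blast
    then show ?thesis using fin nin by simp
  qed
  obtain B where B: "orthonormal_basis_of ?T B"
    by (rule orthonormal_basis_subspace[OF subspace_tangent_space_sphere_product[OF p]])
      (unfold orthonormal_basis_of_def, blast)
  show ?thesis
    unfolding divergence_def
  proof (rule the_equality)
    show "\<exists>B D. orthonormal_basis_of ?T B \<and> (V has_derivative D) (at (x, y) within sphere_product) \<and>
      (\<Sum>b\<in>Basis. L b \<bullet> b) - L (x, 0) \<bullet> (x, 0) - L (0, y) \<bullet> (0, y) = (\<Sum>e\<in>B. D e \<bullet> e)"
      by (intro exI[of _ B] exI[of _ L] conjI B VL tr[OF B, symmetric])
  next
    fix c
    assume "\<exists>B D. orthonormal_basis_of ?T B \<and> (V has_derivative D) (at (x, y) within sphere_product) \<and>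
      c = (\<Sum>e\<in>B. D e \<bullet> e)"
    then obtain B D where B: "orthonormal_basis_of ?T B"
      and D: "(V has_derivative D) (at (x, y) within sphere_product)" and c: "c = (\<Sum>e\<in>B. D e \<bullet> e)"
      by blast
    \<comment> \<open>An arbitrary derivative within the product may differ from \<open>L\<close> in
      normal directions, but \<open>B\<close> consists of tangent vectors.\<close>
    have "D e = L e" if "e \<in> B" for e
      by (rule derivative_unique_on_tangent_space[OF D VL])
        (use B that in \<open>auto simp: orthonormal_basis_of_def\<close>)
    then show "c = (\<Sum>b\<in>Basis. L b \<bullet> b) - L (x, 0) \<bullet> (x, 0) - L (0, y) \<bullet> (0, y)"
      using tr[OF B] c by simp
  qed
qed

section \<open>Sums of squares built from orthonormal systems of linear maps\<close>

text \<open>Separate adjoints \<open>K q\<close> make the two factors interchangeable: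
  \<open>J\<close> acts on the first point and \<open>K\<close> on the second.\<close>

locale orthonormal_system =
  fixes I :: "'i set" and J K :: "'i \<Rightarrow> 'a::euclidean_space \<Rightarrow> 'a"
  assumes finite_I: "finite I" and I_nonempty: "I \<noteq> {}"
    and linear_J: "linear (J q)" and linear_K: "linear (K q)"
    and adjoint: "J q u \<bullet> v = u \<bullet> K q v"
    and J_orth: "p \<in> I \<Longrightarrow> q \<in> I \<Longrightarrow> J p x \<bullet> J q x = (if p = q then x \<bullet> x else 0)"
    and K_orth: "p \<in> I \<Longrightarrow> q \<in> I \<Longrightarrow> K p x \<bullet> K q x = (if p = q then x \<bullet> x else 0)"
begin

definition coef :: "'i \<Rightarrow> 'a \<times> 'a \<Rightarrow> real" where
  "coef q p = J q (fst p) \<bullet> snd p"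

definition sqsum :: "'a \<times> 'a \<Rightarrow> real" where
  "sqsum p = (\<Sum>q\<in>I. (coef q p)\<^sup>2)"

definition wJ :: "'a \<times> 'a \<Rightarrow> 'a" where
  "wJ p = (\<Sum>q\<in>I. coef q p *\<^sub>R J q (fst p))"

definition wK :: "'a \<times> 'a \<Rightarrow> 'a" where
  "wK p = (\<Sum>q\<in>I. coef q p *\<^sub>R K q (snd p))"

text \<open>The ambient gradient has components \<open>2 *\<^sub>R wK p\<close> and
  \<open>2 *\<^sub>R wJ p\<close>; on the unit spheres the subtracted terms are their radial
  parts.\<close>

definition grad :: "'a \<times> 'a \<Rightarrow> 'a \<times> 'a" where
  "grad p = (2 *\<^sub>R wK p - (2 * sqsum p) *\<^sub>R fst p, 2 *\<^sub>R wJ p - (2 * sqsum p) *\<^sub>R snd p)"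

section \<open>Projections to the spans of the two systems\<close>

lemma K_inner: "K q v \<bullet> u = J q u \<bullet> v"
  using adjoint[of q u v] by (simp add: inner_commute)

lemma wK_inner: "wK p \<bullet> u = (\<Sum>q\<in>I. coef q p * (J q u \<bullet> snd p))"
  by (simp add: wK_def inner_sum_left K_inner)

lemma wJ_inner: "wJ p \<bullet> u = (\<Sum>q\<in>I. coef q p * (J q (fst p) \<bullet> u))"
  by (simp add: wJ_def inner_sum_left)

lemma J_inner_wJ: "q \<in> I \<Longrightarrow> J q (fst p) \<bullet> wJ p = coef q p * (fst p \<bullet> fst p)"
  using finite_I by (simp add: wJ_def inner_sum_right J_orth if_distrib sum.delta cong: if_cong)

lemma K_inner_wK: "q \<in> I \<Longrightarrow> K q (snd p) \<bullet> wK p = coef q p * (snd p \<bullet> snd p)"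
  using finite_I by (simp add: wK_def inner_sum_right K_orth if_distrib sum.delta cong: if_cong)

lemma wJ_inner_snd: "wJ p \<bullet> snd p = sqsum p"
  by (simp add: wJ_inner sqsum_def coef_def power2_eq_square)

lemma wK_inner_fst: "wK p \<bullet> fst p = sqsum p"
  by (simp add: wK_inner sqsum_def coef_def power2_eq_square)

text \<open>This is Parseval for the orthogonal vectors \<open>J q (fst p)\<close>, all of the
  length of \<open>fst p\<close>.\<close>

lemma wJ_inner_wJ: "wJ p \<bullet> wJ p = sqsum p * (fst p \<bullet> fst p)"
proof -
  have "wJ p \<bullet> wJ p = (\<Sum>q\<in>I. coef q p * (J q (fst p) \<bullet> wJ p))"
    by (rule wJ_inner)
  also have "\<dots> = sqsum p * (fst p \<bullet> fst p)"
    by (simp add: J_inner_wJ sqsum_def sum_distrib_right power2_eq_square mult.assoc)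
  finally show ?thesis .
qed

lemma wK_inner_wK: "wK p \<bullet> wK p = sqsum p * (snd p \<bullet> snd p)"
proof -
  have "wK p \<bullet> wK p = (\<Sum>q\<in>I. coef q p * (K q (snd p) \<bullet> wK p))"
    by (simp add: wK_inner K_inner[symmetric])
  also have "\<dots> = sqsum p * (snd p \<bullet> snd p)"
    by (simp add: K_inner_wK sqsum_def sum_distrib_right power2_eq_square mult.assoc)
  finally show ?thesis .
qed

lemma sphere_product_inner:
  assumes "p \<in> sphere_product"
  shows "fst p \<bullet> fst p = 1" and "snd p \<bullet> snd p = 1"
  using assms by (auto simp: norm_eq_1)

text \<open>On the unit spheres \<open>wJ p\<close> is an orthogonal projection of
  \<open>snd p\<close>, so Pythagoras applies to the remainder.\<close>

lemma complement_inner_complement: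
  assumes "p \<in> sphere_product"
  shows "(snd p - wJ p) \<bullet> (snd p - wJ p) = 1 - sqsum p"
  using sphere_product_inner[OF assms] wJ_inner_snd[of p] wJ_inner_wJ[of p]
  by (simp add: inner_diff_left inner_diff_right inner_commute)

lemma sqsum_le_1:
  assumes "p \<in> sphere_product"
  shows "sqsum p \<le> 1"
  using complement_inner_complement[OF assms] inner_ge_zero[of "snd p - wJ p"] by linarith

text \<open>With F for \<open>sqsum p\<close>, either side expands to 4F - 8F^2 + 4F^2. The equality
  of the two lengths is the source of the vanishing product angle.\<close>

lemma grad_components:
  assumes "p \<in> sphere_product"
  shows "fst (grad p) \<bullet> fst (grad p) = 4 * sqsum p * (1 - sqsum p)"
    and "snd (grad p) \<bullet> snd (grad p) = 4 * sqsum p * (1 - sqsum p)"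
  using sphere_product_inner[OF assms] wJ_inner_snd[of p] wJ_inner_wJ[of p] wK_inner_fst[of p] wK_inner_wK[of p]
  by (simp_all add: grad_def inner_diff_left inner_diff_right inner_commute algebra_simps)

lemma grad_inner_grad:
  assumes "p \<in> sphere_product"
  shows "grad p \<bullet> grad p = 8 * sqsum p * (1 - sqsum p)"
  using grad_components[OF assms] by (simp add: inner_prod_def)

lemma grad_in_tangent_space:
  assumes "p \<in> sphere_product"
  shows "grad p \<in> tangent_space sphere_product p"
  using assms sphere_product_inner[OF assms] wJ_inner_snd[of p] wK_inner_fst[of p]
  by (cases p) (auto simp: tangent_space_sphere_product grad_def inner_diff_right inner_commute)

section \<open>Ambient derivatives of \<open>sqsum\<close> and \<open>grad\<close>\<close>

definition Dcoef :: "'i \<Rightarrow> 'a \<times> 'a \<Rightarrow> 'a \<times> 'a \<Rightarrow> real" where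
  "Dcoef q p h = J q (fst h) \<bullet> snd p + J q (fst p) \<bullet> snd h"

definition Dsqsum :: "'a \<times> 'a \<Rightarrow> 'a \<times> 'a \<Rightarrow> real" where
  "Dsqsum p h = 2 * (wK p \<bullet> fst h + wJ p \<bullet> snd h)"

definition Dgrad :: "'a \<times> 'a \<Rightarrow> 'a \<times> 'a \<Rightarrow> 'a \<times> 'a" where
  "Dgrad p h =
    (2 *\<^sub>R (\<Sum>q\<in>I. Dcoef q p h *\<^sub>R K q (snd p) + coef q p *\<^sub>R K q (snd h))
       - ((2 * Dsqsum p h) *\<^sub>R fst p + (2 * sqsum p) *\<^sub>R fst h),
     2 *\<^sub>R (\<Sum>q\<in>I. Dcoef q p h *\<^sub>R J q (fst p) + coef q p *\<^sub>R J q (fst h))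
       - ((2 * Dsqsum p h) *\<^sub>R snd p + (2 * sqsum p) *\<^sub>R snd h))"

lemma bounded_linear_J: "bounded_linear (J q)" and bounded_linear_K: "bounded_linear (K q)"
  using linear_J linear_K linear_conv_bounded_linear by auto

lemma J_fst_has_derivative: "((\<lambda>p. J q (fst p)) has_derivative (\<lambda>h. J q (fst h))) F"
  by (intro bounded_linear_imp_has_derivative bounded_linear_compose[OF bounded_linear_J bounded_linear_fst])

lemma K_snd_has_derivative: "((\<lambda>p. K q (snd p)) has_derivative (\<lambda>h. K q (snd h))) F"
  by (intro bounded_linear_imp_has_derivative bounded_linear_compose[OF bounded_linear_K bounded_linear_snd])

lemma coef_has_derivative: "(coef q has_derivative Dcoef q p) (at p)"
proof -
  have "((\<lambda>p. J q (fst p) \<bullet> snd p) has_derivative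
      (\<lambda>h. J q (fst p) \<bullet> snd h + J q (fst h) \<bullet> snd p)) (at p)"
    by (intro has_derivative_inner J_fst_has_derivative has_derivative_snd has_derivative_ident)
  then show ?thesis by (simp add: coef_def[abs_def] Dcoef_def[abs_def] add.commute)
qed

lemma sqsum_has_derivative: "(sqsum has_derivative Dsqsum p) (at p)"
proof -
  have "((\<lambda>p. \<Sum>q\<in>I. coef q p * coef q p) has_derivative
      (\<lambda>h. \<Sum>q\<in>I. coef q p * Dcoef q p h + Dcoef q p h * coef q p)) (at p)"
    by (intro has_derivative_sum has_derivative_mult coef_has_derivative)
  moreover have "(\<Sum>q\<in>I. coef q p * Dcoef q p h + Dcoef q p h * coef q p) = Dsqsum p h" for h
    by (simp add: Dsqsum_def Dcoef_def wJ_inner wK_inner sum.distrib[symmetric]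
        sum_distrib_left algebra_simps)
  ultimately show ?thesis by (simp add: sqsum_def[abs_def] power2_eq_square)
qed

lemma grad_has_derivative: "(grad has_derivative Dgrad p) (at p)"
proof -
  have J: "(wJ has_derivative (\<lambda>h. \<Sum>q\<in>I. coef q p *\<^sub>R J q (fst h) + Dcoef q p h *\<^sub>R J q (fst p))) (at p)"
    unfolding wJ_def[abs_def]
    by (intro has_derivative_sum has_derivative_scaleR coef_has_derivative J_fst_has_derivative)
  have K: "(wK has_derivative (\<lambda>h. \<Sum>q\<in>I. coef q p *\<^sub>R K q (snd h) + Dcoef q p h *\<^sub>R K q (snd p))) (at p)"
    unfolding wK_def[abs_def]
    by (intro has_derivative_sum has_derivative_scaleR coef_has_derivative K_snd_has_derivative)
  show ?thesis
    unfolding grad_def[abs_def]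
    by (rule derivative_eq_intros J K sqsum_has_derivative refl)+
      (simp add: Dgrad_def fun_eq_iff algebra_simps)
qed

text \<open>The radial terms of \<open>grad\<close> vanish against tangent vectors.\<close>

lemma Dsqsum_eq_grad_inner:
  assumes "p \<in> sphere_product" and "h \<in> tangent_space sphere_product p"
  shows "Dsqsum p h = grad p \<bullet> h"
  using assms
  by (cases p; cases h)
    (auto simp: tangent_space_sphere_product Dsqsum_def grad_def inner_diff_left)

lemma gradient_sqsum:
  assumes "p \<in> sphere_product"
  shows "gradient sphere_product sqsum p = grad p"
  by (rule gradient_eqI[where D = "Dsqsum p"])
    (use assms in \<open>auto intro: subspace_tangent_space_sphere_product grad_in_tangent_space
        has_derivative_at_withinI sqsum_has_derivative Dsqsum_eq_grad_inner\<close>)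

section \<open>The trace of the derivative and the Laplacian\<close>

lemma norm_square_K: "q \<in> I \<Longrightarrow> (\<Sum>b\<in>Basis. (J q b \<bullet> y) * (J q b \<bullet> y)) = y \<bullet> y"
  using K_orth[of q q y] by (simp add: K_inner[symmetric] euclidean_inner[of "K q y" "K q y"])

lemma norm_square_J: "q \<in> I \<Longrightarrow> (\<Sum>b\<in>Basis. (J q x \<bullet> b) * (J q x \<bullet> b)) = x \<bullet> x"
  using J_orth[of q q x] by (simp add: euclidean_inner[of "J q x" "J q x"])

text \<open>Vectors from a single factor produce no mixed terms, and the basis of the product
  consists of such vectors.\<close>

lemma Dgrad_inner_fst:
  "Dgrad p (u, 0) \<bullet> (u, 0) =
    2 * (\<Sum>q\<in>I. (J q u \<bullet> snd p) * (J q u \<bullet> snd p)) - 4 * (wK p \<bullet> u) * (fst p \<bullet> u) - 2 * sqsum p * (u \<bullet> u)"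
proof -
  have "K q 0 = 0" for q using linear_0[OF linear_K] .
  then show ?thesis
    by (simp add: Dgrad_def Dcoef_def Dsqsum_def inner_diff_left inner_add_left inner_sum_left K_inner)
qed

lemma Dgrad_inner_snd:
  "Dgrad p (0, v) \<bullet> (0, v) =
    2 * (\<Sum>q\<in>I. (J q (fst p) \<bullet> v) * (J q (fst p) \<bullet> v)) - 4 * (wJ p \<bullet> v) * (snd p \<bullet> v) - 2 * sqsum p * (v \<bullet> v)"
proof -
  have "J q 0 = 0" for q using linear_0[OF linear_J] .
  then show ?thesis
    by (simp add: Dgrad_def Dcoef_def Dsqsum_def inner_diff_left inner_add_left inner_sum_left)
qed

text \<open>In each factor the squares, summed over \<open>Basis\<close>, give 1 for each
  \<open>q\<close>, since \<open>J q\<close> and \<open>K q\<close> preserve length; the rank one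
  term gives \<open>sqsum p\<close>, and the scalar term gives the dimension.\<close>

lemma trace_Dgrad:
  assumes "p \<in> sphere_product"
  shows "(\<Sum>b\<in>Basis. Dgrad p b \<bullet> b) = 4 * card I - 8 * sqsum p - 4 * sqsum p * DIM('a)"
proof -
  note xy = sphere_product_inner[OF assms]
  have 1: "(\<Sum>b\<in>Basis. \<Sum>q\<in>I. (J q b \<bullet> snd p) * (J q b \<bullet> snd p)) = card I"
    by (subst sum.swap) (simp add: norm_square_K xy)
  have 2: "(\<Sum>b\<in>Basis. \<Sum>q\<in>I. (J q (fst p) \<bullet> b) * (J q (fst p) \<bullet> b)) = card I"
    by (subst sum.swap) (simp add: norm_square_J xy)
  have 3: "(\<Sum>b\<in>Basis. (wK p \<bullet> b) * (fst p \<bullet> b)) = sqsum p"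
    using wK_inner_fst[of p] by (simp add: euclidean_inner[of "wK p" "fst p"])
  have 4: "(\<Sum>b\<in>Basis. (wJ p \<bullet> b) * (snd p \<bullet> b)) = sqsum p"
    using wJ_inner_snd[of p] by (simp add: euclidean_inner[of "wJ p" "snd p"])
  have "(\<Sum>b\<in>Basis. Dgrad p b \<bullet> b) =
      (\<Sum>b\<in>Basis. Dgrad p (b, 0) \<bullet> (b, 0)) + (\<Sum>b\<in>Basis. Dgrad p (0, b) \<bullet> (0, b))"
    unfolding Basis_prod_def
    by (subst sum.union_disjoint) (auto simp: sum.reindex inj_on_def)
  also have "(\<Sum>b\<in>Basis. Dgrad p (b, 0) \<bullet> (b, 0)) = 2 * card I - 4 * sqsum p - 2 * sqsum p * DIM('a)"
    unfolding Dgrad_inner_fst mult.assoc[of 4] sum_subtractf sum_distrib_left[symmetric] 1 3 by simp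
  also have "(\<Sum>b\<in>Basis. Dgrad p (0, b) \<bullet> (0, b)) = 2 * card I - 4 * sqsum p - 2 * sqsum p * DIM('a)"
    unfolding Dgrad_inner_snd mult.assoc[of 4] sum_subtractf sum_distrib_left[symmetric] 2 4 by simp
  finally show ?thesis by simp
qed

text \<open>With F for \<open>sqsum p\<close>, each normal direction contributes 2F - 4F - 2F = -4F.
  Removing both cancels the \<open>- 8 * sqsum p\<close> of the ambient trace.\<close>

lemma laplacian_sqsum:
  assumes "p \<in> sphere_product"
  shows "laplacian sphere_product sqsum p = 4 * card I - 4 * DIM('a) * sqsum p"
proof -
  obtain x y where p: "p = (x, y)" by fastforce
  note xy = sphere_product_inner[OF assms]
  have sq: "(\<Sum>q\<in>I. (J q x \<bullet> y) * (J q x \<bullet> y)) = sqsum p"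
    by (simp add: sqsum_def coef_def p power2_eq_square)
  have "laplacian sphere_product sqsum (x, y) =
      (\<Sum>b\<in>Basis. Dgrad (x, y) b \<bullet> b) - Dgrad (x, y) (x, 0) \<bullet> (x, 0) - Dgrad (x, y) (0, y) \<bullet> (0, y)"
    unfolding laplacian_def
    by (rule divergence_sphere_product) (use assms p gradient_sqsum grad_has_derivative in auto)
  moreover have "Dgrad (x, y) (x, 0) \<bullet> (x, 0) = - 4 * sqsum p"
    using wK_inner_fst[of p] xy sq unfolding Dgrad_inner_fst p by simp
  moreover have "Dgrad (x, y) (0, y) \<bullet> (0, y) = - 4 * sqsum p"
    using wJ_inner_snd[of p] xy sq unfolding Dgrad_inner_snd p by simp
  ultimately show ?thesis
    using trace_Dgrad[OF assms] unfolding p by simp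
qed

section \<open>Smoothness and the isoparametric property\<close>

lemma elementary_coef:
  assumes "elementary_map_on S \<xi>" and "elementary_map_on S \<eta>"
  shows "elementary_on S (\<lambda>s. coef q (\<xi> s, \<eta> s))"
  unfolding coef_def fst_conv snd_conv by (intro elementary_on_inner elementary_map_on_linear[OF linear_J] assms)

lemma elementary_sqsum:
  assumes "elementary_map_on S \<xi>" and "elementary_map_on S \<eta>"
  shows "elementary_on S (\<lambda>s. sqsum (\<xi> s, \<eta> s))"
  unfolding sqsum_def power2_eq_square by (intro elementary_on_sum elementary_on.mult elementary_coef assms)

lemma elementary_wJ:
  assumes "elementary_map_on S \<xi>" and "elementary_map_on S \<eta>"
  shows "elementary_map_on S (\<lambda>s. wJ (\<xi> s, \<eta> s))"
  unfolding wJ_def fst_conv 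
  by (intro elementary_map_on_sum elementary_map_on_scaleR elementary_coef
      elementary_map_on_linear[OF linear_J] assms)

lemma smooth_sqsum: "smooth_on sqsum UNIV"
proof -
  have "elementary_map_on UNIV (\<lambda>p::'a \<times> 'a. fst p)" "elementary_map_on UNIV (\<lambda>p::'a \<times> 'a. snd p)"
    by (rule elementary_map_on_linear[OF linear_fst elementary_map_on_id]
        elementary_map_on_linear[OF linear_snd elementary_map_on_id])+
  from elementary_sqsum[OF this] show ?thesis
    by (intro elementary_map_on_smooth) simp_all
qed

lemma isoparametric_sqsum:
  assumes "\<not> sqsum constant_on sphere_product"
  shows "isoparametric_function sphere_product sqsum"
proof -
  \<comment> \<open>The polynomials for \<open>a\<close> and \<open>b\<close> are written with sums
    and products only, to fit the closure rules of the elementary class.\<close>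
  have "elementary_on UNIV (\<lambda>s::real. 4 * real (card I) + (- 4 * real DIM('a)) * s)"
      "elementary_on UNIV (\<lambda>s::real. 8 * s * (1 + (- 1) * s))"
    by (intro elementary_intros elementary_on_linear_real)+
  then have "smooth_on (\<lambda>s::real. 4 * real (card I) + (- 4 * real DIM('a)) * s) UNIV"
      "smooth_on (\<lambda>s::real. 8 * s * (1 + (- 1) * s)) UNIV"
    by (auto intro: elementary_map_on_smooth)
  moreover have "smooth_function_on sphere_product sqsum"
    unfolding smooth_function_on_def using smooth_sqsum by blast
  moreover have "(norm (gradient sphere_product sqsum p))\<^sup>2 = 8 * sqsum p * (1 + (- 1) * sqsum p) \<and>
      laplacian sphere_product sqsum p = 4 * real (card I) + (- 4 * real DIM('a)) * sqsum p"
    if "p \<in> sphere_product" for p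
    using that by (simp add: gradient_sqsum grad_inner_grad laplacian_sqsum power2_norm_eq_inner)
  ultimately show ?thesis
    unfolding isoparametric_function_def using assms by blast
qed

text \<open>Non-constancy excludes the value 1 everywhere. A point with a smaller value yields a
  unit vector \<open>z\<close> orthogonal to all \<open>J q x\<close>, and the arc from
  \<open>z\<close> to \<open>J i x\<close> passes through every value between 0 and 1.\<close>

lemma level_set_nonempty:
  assumes "\<not> sqsum constant_on sphere_product" and t: "0 < t" "t < 1"
  shows "{p \<in> sphere_product. sqsum p = t} \<noteq> {}"
proof -
  obtain i where i: "i \<in> I" using I_nonempty by blast
  obtain p where p: "p \<in> sphere_product" and "sqsum p \<noteq> 1"
    using assms(1) unfolding constant_on_def by blast
  with sqsum_le_1 have lt: "sqsum p < 1" by fastforce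
  define x where "x = fst p"
  define r where "r = sqrt (1 - sqsum p)"
  define z where "z = (1 / r) *\<^sub>R (snd p - wJ p)"
  have r: "r * r = 1 - sqsum p" "r > 0" using lt by (auto simp: r_def)
  have x: "x \<bullet> x = 1" using sphere_product_inner[OF p] by (simp add: x_def)
  have z: "z \<bullet> z = 1"
    using complement_inner_complement[OF p] r lt by (simp add: z_def)
  have Jz: "J q x \<bullet> z = 0" if "q \<in> I" for q
    using J_inner_wJ[OF that, of p] x by (simp add: z_def x_def coef_def inner_diff_right)
  \<comment> \<open>The squared weights add up to 1, and the only nonzero coefficient of
    \<open>y\<close> is \<open>sqrt t\<close>, at \<open>i\<close>.\<close>
  define y where "y = sqrt t *\<^sub>R J i x + sqrt (1 - t) *\<^sub>R z"
  have "y \<bullet> y = 1"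
    using t z x i Jz[OF i] J_orth[OF i i, of x]
    by (simp add: y_def inner_add_left inner_add_right inner_commute)
  moreover have "coef q (x, y) = (if q = i then sqrt t else 0)" if "q \<in> I" for q
    using that i J_orth[OF that i, of x] Jz x by (simp add: coef_def y_def inner_add_right)
  then have "sqsum (x, y) = (\<Sum>q\<in>I. if q = i then t else 0)"
    unfolding sqsum_def by (intro sum.cong) (use t in auto)
  then have "sqsum (x, y) = t" using i finite_I by simp
  ultimately have "(x, y) \<in> {p \<in> sphere_product. sqsum p = t}" using x by (simp add: norm_eq_1)
  then show ?thesis by blast
qed

lemma isoparametric_hypersurface_level_set:
  assumes "\<not> sqsum constant_on sphere_product" and t: "0 < t" "t < 1"
  shows "isoparametric_hypersurface sphere_product {p \<in> sphere_product. sqsum p = t}"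
proof -
  have "gradient sphere_product sqsum p \<noteq> 0" if "p \<in> sphere_product" "sqsum p = t" for p
    using grad_inner_grad[OF that(1)] gradient_sqsum[OF that(1)] that(2) t by auto
  then show ?thesis
    unfolding isoparametric_hypersurface_def regular_level_set_def
    using isoparametric_sqsum[OF assms(1)] level_set_nonempty[OF assms] by blast
qed

section \<open>Retraction onto a level set, its tangent and normal vectors\<close>

definition retract :: "real \<Rightarrow> 'a \<times> 'a \<Rightarrow> 'a \<times> 'a" where
  "retract t p =
    (fst p, (sqsum p / t) powr (-1/2) *\<^sub>R wJ p + ((1 - sqsum p) / (1 - t)) powr (-1/2) *\<^sub>R (snd p - wJ p))"

text \<open>The first point is kept, and with it the span of the \<open>J q (fst p)\<close>. The
  factors rescale the two orthogonal parts of \<open>snd p\<close> to squared lengths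
  \<open>t\<close> and \<open>1 - t\<close>.\<close>

lemma retract_in_level_set:
  assumes p: "p \<in> sphere_product" and F: "0 < sqsum p" "sqsum p < 1" and t: "0 < t" "t < 1"
  shows "retract t p \<in> {p \<in> sphere_product. sqsum p = t}"
proof -
  note xy = sphere_product_inner[OF p]
  define a where "a = (sqsum p / t) powr (-1/2)"
  define b where "b = ((1 - sqsum p) / (1 - t)) powr (-1/2)"
  define y where "y = a *\<^sub>R wJ p + b *\<^sub>R (snd p - wJ p)"
  have R: "retract t p = (fst p, y)" by (simp add: retract_def y_def a_def b_def)
  have a: "a * a * sqsum p = t" unfolding a_def using F t by (subst powr_minus_half_square) auto
  have b: "b * b * (1 - sqsum p) = 1 - t" unfolding b_def using F t by (subst powr_minus_half_square) auto
  have orth: "wJ p \<bullet> (snd p - wJ p) = 0"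
    using wJ_inner_snd[of p] wJ_inner_wJ[of p] xy by (simp add: inner_diff_right)
  have "y \<bullet> y = a * a * (wJ p \<bullet> wJ p) + b * b * ((snd p - wJ p) \<bullet> (snd p - wJ p))"
    unfolding y_def inner_add_left inner_add_right inner_scaleR_left inner_scaleR_right
    by (simp add: orth inner_commute[of "snd p - wJ p" "wJ p"])
  then have "y \<bullet> y = 1"
    using a b complement_inner_complement[OF p] wJ_inner_wJ[of p] xy by simp
  moreover have "coef q (fst p, y) = a * coef q p" if "q \<in> I" for q
    using J_inner_wJ[OF that, of p] xy
    by (simp add: coef_def y_def inner_add_right inner_diff_right)
  then have "sqsum (fst p, y) = a * a * sqsum p"
    by (simp add: sqsum_def power_mult_distrib sum_distrib_left power2_eq_square mult_ac)
  ultimately show ?thesis using R xy a by (simp add: norm_eq_1)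
qed

lemma retract_id:
  assumes "sqsum p = t" and "0 < t" "t < 1"
  shows "retract t p = p"
  using assms by (simp add: retract_def)

text \<open>Normalized lines are retracted into the level set. The scaling factors depend on
  \<open>s\<close> only through \<open>sqsum\<close> along the lines, which has derivative
  \<open>grad p \<bullet> v = 0\<close> at 0, so the velocity \<open>v\<close> survives.\<close>

lemma tangent_space_level_set:
  assumes p: "p \<in> sphere_product" "sqsum p = t" and t: "0 < t" "t < 1"
    and v: "v \<in> tangent_space sphere_product p" "grad p \<bullet> v = 0"
  shows "v \<in> tangent_space {p \<in> sphere_product. sqsum p = t} p"
proof -
  obtain x y where xy: "p = (x, y)" by fastforce
  obtain v1 v2 where v12: "v = (v1, v2)" by fastforce
  have orth: "x \<bullet> v1 = 0" "y \<bullet> v2 = 0"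
    using v(1) p(1) by (auto simp: xy v12 tangent_space_sphere_product)
  define \<xi> where "\<xi> = normalized_line x v1"
  define \<eta> where "\<eta> = normalized_line y v2"
  have el: "elementary_map_on S \<xi>" "elementary_map_on S \<eta>" for S
    by (simp_all add: \<xi>_def \<eta>_def elementary_normalized_line)
  have sph: "(\<xi> s, \<eta> s) \<in> sphere_product" for s
    unfolding \<xi>_def \<eta>_def using normalized_lines_in_sphere_product[of x y v1 v2] p(1) orth xy by blast
  have at0: "(\<xi> 0, \<eta> 0) = p" by (simp add: \<xi>_def \<eta>_def xy)
  have d\<eta>: "(\<eta> has_vector_derivative v2) (at 0)" and d\<xi>: "(\<xi> has_vector_derivative v1) (at 0)"
    by (simp_all add: \<xi>_def \<eta>_def normalized_line_has_vector_derivative)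
  then have dc: "((\<lambda>s. (\<xi> s, \<eta> s)) has_vector_derivative v) (at 0)"
    unfolding v12 by (rule has_vector_derivative_Pair[rotated])
  define \<phi> where "\<phi> s = sqsum (\<xi> s, \<eta> s)" for s
  have "((\<lambda>s. sqsum (\<xi> s, \<eta> s)) has_vector_derivative Dsqsum p v) (at 0)"
    by (rule has_vector_derivative_along_curve[of sqsum _ p UNIV 1])
      (use sqsum_has_derivative at0 dc in auto)
  then have d\<phi>: "(\<phi> has_real_derivative 0) (at 0)"
    using Dsqsum_eq_grad_inner[OF p(1) v(1)] v(2)
    by (simp add: \<phi>_def[abs_def] has_real_derivative_iff_has_vector_derivative)
  have \<phi>0: "\<phi> 0 = t" using at0 p(2) by (simp add: \<phi>_def)
  \<comment> \<open>Continuity keeps \<open>\<phi>\<close> strictly between 0 and 1 near 0, so that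
    the bases of both powers stay positive.\<close>
  have "((\<lambda>s. \<phi> s) \<longlongrightarrow> t) (at 0)"
    using DERIV_isCont[OF d\<phi>] \<phi>0 by (simp add: isCont_def)
  then have "\<forall>\<^sub>F s in at 0. \<phi> s \<in> {0<..<1}"
    by (rule topological_tendstoD) (use t in auto)
  then obtain \<epsilon> where \<epsilon>: "0 < \<epsilon>" "\<And>s. s \<noteq> 0 \<Longrightarrow> dist s 0 < \<epsilon> \<Longrightarrow> \<phi> s \<in> {0<..<1}"
    unfolding eventually_at by blast
  let ?S = "{-\<epsilon><..<\<epsilon>}"
  have \<phi>: "0 < \<phi> s" "\<phi> s < 1" if "s \<in> ?S" for s
    using \<epsilon>(2)[of s] that \<phi>0 t by (cases "s = 0"; auto simp: dist_real_def)+
  define \<alpha> where "\<alpha> s = ((1/t) * \<phi> s) powr (-1/2)" for s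
  define \<beta> where "\<beta> s = ((1 / (1-t)) * (1 + (-1) * \<phi> s)) powr (-1/2)" for s
  define w where "w s = wJ (\<xi> s, \<eta> s)" for s
  define \<gamma> where "\<gamma> s = (\<xi> s, \<alpha> s *\<^sub>R w s + \<beta> s *\<^sub>R (\<eta> s - w s))" for s
  have \<gamma>: "\<gamma> s = retract t (\<xi> s, \<eta> s)" for s
    by (simp add: \<gamma>_def \<alpha>_def \<beta>_def w_def \<phi>_def retract_def)
  have "elementary_map_on ?S \<gamma>"
    unfolding \<gamma>_def[abs_def] \<alpha>_def \<beta>_def w_def
    using \<phi> t unfolding \<phi>_def
    by (intro elementary_intros elementary_wJ elementary_sqsum el) auto
  then have "smooth_on \<gamma> ?S" by (simp add: elementary_map_on_smooth)
  moreover have "\<gamma> ` ?S \<subseteq> {p \<in> sphere_product. sqsum p = t}"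
    using retract_in_level_set[OF sph _ _ t] \<phi> unfolding \<gamma> \<phi>_def by blast
  moreover have "\<gamma> 0 = p"
    unfolding \<gamma> at0 by (rule retract_id[OF p(2) t])
  moreover have "(\<gamma> has_vector_derivative v) (at 0)"
  proof -
    have d\<alpha>: "(\<alpha> has_real_derivative 0) (at 0)" and d\<beta>: "(\<beta> has_real_derivative 0) (at 0)"
      unfolding \<alpha>_def[abs_def] \<beta>_def[abs_def] using d\<phi> \<phi>0 t
      by (auto intro!: derivative_eq_intros)
    have 1: "\<alpha> 0 = 1" "\<beta> 0 = 1" using \<phi>0 t by (auto simp: \<alpha>_def \<beta>_def)
    \<comment> \<open>Only the existence of a derivative \<open>w'\<close> matters: it cancels
      because both factors are 1 and stationary at 0.\<close>
    have "elementary_map_on UNIV w"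
      unfolding w_def[abs_def] by (intro elementary_wJ el)
    then have "w differentiable_on UNIV"
      using elementary_map_on_smooth[of UNIV w] unfolding smooth_on_def by (metis Ck_on.simps(2) open_UNIV)
    then obtain w' where "(w has_vector_derivative w') (at 0)"
      using differentiable_on_def vector_derivative_works by blast
    then have "((\<lambda>s. \<alpha> s *\<^sub>R w s + \<beta> s *\<^sub>R (\<eta> s - w s)) has_vector_derivative
        (\<alpha> 0 *\<^sub>R w' + 0 *\<^sub>R w 0) + (\<beta> 0 *\<^sub>R (v2 - w') + 0 *\<^sub>R (\<eta> 0 - w 0))) (at 0)"
      by (intro has_vector_derivative_add has_vector_derivative_scaleR has_vector_derivative_diff d\<alpha> d\<beta> d\<eta>)
    then have "((\<lambda>s. \<alpha> s *\<^sub>R w s + \<beta> s *\<^sub>R (\<eta> s - w s)) has_vector_derivative v2) (at 0)"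
      by (simp add: 1)
    then show ?thesis
      unfolding \<gamma>_def[abs_def] v12 by (intro has_vector_derivative_Pair d\<xi>)
  qed
  ultimately show ?thesis
    unfolding tangent_space_def using \<epsilon>(1) by blast
qed

text \<open>A curve in the level set is also a curve in the sphere product, and \<open>sqsum\<close>
  is constant along it.\<close>

lemma grad_orthogonal_level_set:
  assumes p: "p \<in> sphere_product" and v: "v \<in> tangent_space {p \<in> sphere_product. sqsum p = t} p"
  shows "grad p \<bullet> v = 0"
proof -
  let ?M = "{p \<in> sphere_product. sqsum p = t}"
  obtain \<gamma> \<epsilon> where e: "0 < \<epsilon>" "\<gamma> ` {-\<epsilon><..<\<epsilon>} \<subseteq> ?M" "smooth_on \<gamma> {-\<epsilon><..<\<epsilon>}"
    "\<gamma> 0 = p" "(\<gamma> has_vector_derivative v) (at 0)"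
    using v unfolding tangent_space_def by blast
  have 1: "((\<lambda>s. sqsum (\<gamma> s)) has_vector_derivative Dsqsum p v) (at 0)"
    by (rule has_vector_derivative_along_curve[OF has_derivative_at_withinI[OF sqsum_has_derivative] e(1,2,4,5)])
  have 2: "((\<lambda>s. sqsum (\<gamma> s)) has_vector_derivative 0) (at 0)"
    by (rule has_vector_derivative_transform_within_open[of "\<lambda>s. t" _ _ "{-\<epsilon><..<\<epsilon>}"])
      (use e(1,2) in \<open>auto simp: image_subset_iff\<close>)
  have "v \<in> tangent_space sphere_product p"
    using e unfolding tangent_space_def by blast
  then show ?thesis
    using vector_derivative_unique_at[OF 1 2] Dsqsum_eq_grad_inner[OF p] by simp
qed

text \<open>Every unit normal is a multiple of \<open>grad p\<close>, whose two components have
  equal length and therefore cancel under the product structure.\<close>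

lemma product_angle_level_set:
  assumes p: "p \<in> sphere_product" "sqsum p = t" and t: "0 < t" "t < 1"
  shows "product_angle {p \<in> sphere_product. sqsum p = t} p = 0"
proof -
  let ?M = "{p \<in> sphere_product. sqsum p = t}" and ?T = "tangent_space sphere_product p"
  let ?G = "grad p"
  have GG: "?G \<bullet> ?G \<noteq> 0" using grad_inner_grad[OF p(1)] p(2) t by simp
  have angle: "product_structure (c *\<^sub>R ?G) \<bullet> (c *\<^sub>R ?G) = 0" for c
    using grad_components[OF p(1)] by (simp add: product_structure_def inner_prod_def)
  note sub = subspace_tangent_space_sphere_product[OF p(1)]
  note G = grad_in_tangent_space[OF p(1)]
  have normal: "unit_normal_at sphere_product ?M p ((1 / norm ?G) *\<^sub>R ?G)"
    unfolding unit_normal_at_def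
    using GG subspace_scale[OF sub G] grad_orthogonal_level_set[OF p(1)] by auto
  have line: "\<exists>c. N = c *\<^sub>R ?G" if N: "unit_normal_at sphere_product ?M p N" for N
  proof -
    \<comment> \<open>The part of \<open>N\<close> orthogonal to the gradient is tangent to the
      level set, hence orthogonal to \<open>N\<close> as well, and so to itself.\<close>
    define c where "c = (?G \<bullet> N) / (?G \<bullet> ?G)"
    have d: "N - c *\<^sub>R ?G \<in> ?T" "?G \<bullet> (N - c *\<^sub>R ?G) = 0"
      using N GG subspace_diff[OF sub _ subspace_scale[OF sub G]]
      by (auto simp: unit_normal_at_def c_def inner_diff_right)
    then have "N \<bullet> (N - c *\<^sub>R ?G) = 0"
      using N tangent_space_level_set[OF p t] by (auto simp: unit_normal_at_def)
    with d(2) have "(N - c *\<^sub>R ?G) \<bullet> (N - c *\<^sub>R ?G) = 0"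
      by (simp add: inner_diff_left)
    then show ?thesis by auto
  qed
  show ?thesis
    unfolding product_angle_def
  proof (rule the_equality)
    show "\<exists>N. unit_normal_at sphere_product ?M p N \<and> 0 = product_structure N \<bullet> N"
      by (intro exI[of _ "(1 / norm ?G) *\<^sub>R ?G"] conjI normal angle[symmetric])
  qed (use line angle in blast)
qed

end

section \<open>The Clifford matrices as an orthonormal system\<close>

theorem theoremA:
  fixes n m :: nat
    and A :: "nat \<Rightarrow> real ^ 'k ^ 'k"
    and F :: "(real ^ 'k) \<times> (real ^ 'k) \<Rightarrow> real"
  assumes "n \<ge> 1" and "m \<ge> 1" and "CARD('k) = n + 1"
    and "\<forall>p\<in>{1..m-1}. transpose (A p) = - A p"
    and "\<forall>p\<in>{1..m-1}. \<forall>q\<in>{1..m-1}.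
           A p ** A q + A q ** A p = (- 2 * (if p = q then 1 else 0)) *\<^sub>R mat 1"
    and "\<forall>x y. F (x, y) = (x \<bullet> y)\<^sup>2 + (\<Sum>q\<in>{1..m-1}. ((A q *v x) \<bullet> y)\<^sup>2)"
    and "\<not> F constant_on sphere_product"
  shows "isoparametric_function sphere_product F \<and>
         (\<forall>t\<in>{0<..<1}.
            isoparametric_hypersurface sphere_product {p \<in> sphere_product. F p = t} \<and>
            (\<forall>p\<in>{p \<in> sphere_product. F p = t}.
               product_angle {p \<in> sphere_product. F p = t} p = 0))"
proof -
  \<comment> \<open>The matrices are numbered from 1, so index 0 is free for the identity and the
    system has the \<open>m\<close> indices \<open>{..<m}\<close>.\<close>
  define J :: "nat \<Rightarrow> real ^ 'k \<Rightarrow> real ^ 'k" where "J q = (if q = 0 then (\<lambda>x. x) else (*v) (A q))" for q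
  \<comment> \<open>Transposes, unlike negatives, are adjoints for every \<open>q\<close>, also
    outside the range of the hypotheses.\<close>
  define K :: "nat \<Rightarrow> real ^ 'k \<Rightarrow> real ^ 'k" where
    "K q = (if q = 0 then (\<lambda>x. x) else (*v) (transpose (A q)))" for q
  have adj: "(A q *v x) \<bullet> y = x \<bullet> (transpose (A q) *v y)" for q x y
    using dot_lmul_matrix[of y "A q" x] by (simp add: inner_commute)
  have neg: "(- B) *v x = - (B *v x)" for B :: "real ^ 'k ^ 'k" and x
    using matrix_vector_mult_diff_rdistrib[of 0 B x] by simp
  have skew: "(A q *v x) \<bullet> y = - (x \<bullet> (A q *v y))" if "q \<in> {1..m-1}" for q x y
    by (simp only: adj bspec[OF assms(4) that] neg inner_minus_right)
  have clifford: "(A p *v x) \<bullet> (A q *v x) = (if p = q then x \<bullet> x else 0)"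
    if pq: "p \<in> {1..m-1}" "q \<in> {1..m-1}" for p q x
  proof -
    \<comment> \<open>The Clifford relation is applied to \<open>x\<close> and paired with
      \<open>x\<close>; skewness then turns both terms on the left into the same inner
      product.\<close>
    have "A p *v (A q *v x) + A q *v (A p *v x) = (- 2 * (if p = q then 1 else 0)) *\<^sub>R x"
      using assms(5) pq unfolding matrix_vector_mul_assoc matrix_vector_mult_add_rdistrib[symmetric]
      by (simp only: scaleR_matrix_vector_assoc[symmetric] matrix_vector_mul_lid)
    then have "x \<bullet> (A p *v (A q *v x)) + x \<bullet> (A q *v (A p *v x)) = (- 2 * (if p = q then 1 else 0)) * (x \<bullet> x)"
      by (simp only: inner_add_right[symmetric] inner_scaleR_right)
    moreover have "x \<bullet> (A p *v (A q *v x)) = - ((A p *v x) \<bullet> (A q *v x))"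
      using skew[OF pq(1), of x "A q *v x"] by simp
    moreover have "x \<bullet> (A q *v (A p *v x)) = - ((A p *v x) \<bullet> (A q *v x))"
      using skew[OF pq(2), of x "A p *v x"] by (simp add: inner_commute)
    ultimately show ?thesis by (simp split: if_splits)
  qed
  \<comment> \<open>This covers the pairs formed by the identity \<open>J 0\<close> and a
    matrix.\<close>
  have perp: "x \<bullet> (A q *v x) = 0" if "q \<in> {1..m-1}" for q x
    using skew[OF that, of x x] by (simp add: inner_commute)
  have I: "q \<in> {1..m-1} \<longleftrightarrow> q \<noteq> 0" if "q \<in> {..<m}" for q using that by auto
  have orth: "J p x \<bullet> J q x = (if p = q then x \<bullet> x else 0)" if "p \<in> {..<m}" "q \<in> {..<m}" for p q x
    using clifford perp I that by (auto simp: J_def inner_commute)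
  have K: "K q x = (if q = 0 then x else - J q x)" if "q \<in> {..<m}" for q x
    using bspec[OF assms(4), of q] I[OF that]
    by (simp add: K_def J_def neg del: transpose_matrix_vector)
  interpret orthonormal_system "{..<m}" J K
  proof (rule orthonormal_system.intro)
    show "{..<m} \<noteq> {}" using assms(2) by (auto simp: lessThan_empty_iff)
    show "linear (J q)" "linear (K q)" for q
      by (auto simp: J_def K_def linear_id[unfolded id_def])
    show "J q u \<bullet> v = u \<bullet> K q v" for q u v
      by (simp add: J_def K_def adj del: transpose_matrix_vector)
    show "J p x \<bullet> J q x = (if p = q then x \<bullet> x else 0)" if "p \<in> {..<m}" "q \<in> {..<m}" for p q x
      using orth that .
    show "K p x \<bullet> K q x = (if p = q then x \<bullet> x else 0)" if "p \<in> {..<m}" "q \<in> {..<m}" for p q x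
      \<comment> \<open>\<open>K q\<close> agrees with \<open>J q\<close> up to sign, and the signs
        can differ only for \<open>p \<noteq> q\<close>, where the inner product is 0.\<close>
      using orth[OF that, of x] by (auto simp: K[OF that(1)] K[OF that(2)] J_def)
  qed simp
  have "F p = sqsum p" for p
  proof -
    have m: "{..<m} = insert 0 {1..m-1}" using assms(2) by auto
    show ?thesis
      unfolding sqsum_def unfolding m using assms(6) by (cases p) (simp add: coef_def J_def)
  qed
  then have "F = sqsum" by blast
  then show ?thesis
    using assms(7) isoparametric_sqsum isoparametric_hypersurface_level_set product_angle_level_set
    by auto
qed

end
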